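(* Let $G(V,E)$ be a $k$-uniform hypergraph with $n=|V|$, $m=|E|$, and dependency $d=d(G)$, and let $x$ be a positive integer with $d\le \frac{2^{x(k-1)}}{e}-1$. Then $G$ has a bicoloring cover of size $x$, and the following randomized algorithm computes one: independently assign to every vertex $v$ and every $i\in\{1,\dots,x\}$ a uniformly random bit $r_v^i$ (the color of $v$ in the $i$-th bicoloring); while some hyperedge $e$ is monochromatic in every one of the $x$ bicolorings, pick such a hyperedge and resample, independently and uniformly, the bits $r_v^i$ for all $v\in e$ and all $i\in\{1,\dots,x\}$. This algorithm uses an expected $\frac{1}{d}$ resamplings per hyperedge and $\frac{m}{d}$ resamplings in total, and uses an expected $nx+kx\frac{m}{d}$ random bits.
   Context: A bicoloring of $G$ is a map $X:V\to\{0,1\}$; a bicoloring cover of $G$ is a set of bicolorings such that every hyperedge is non-monochromatic under at least one of them. The dependency $d(G,e)$ of a hyperedge $e$ is the number of hyperedges of $G$ with which $e$ shares at least one vertex, and the dependency $d(G)$ of $G$ is the maximum of $d(G,e)$ over all hyperedges $e$. Here $e$ also denotes Euler's number in the bound $\frac{2^{x(k-1)}}{e}-1$.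
   Formalization: The expected numbers of resamplings and random bits are proved as upper bounds ("at most"), since equality is false in general (for d = 0 they are vacuous); the cover has exactly x distinct bicolorings if x ≤ 2^n, and at most x otherwise, when no x distinct ones exist. *)

theory Defs
  imports "HOL-Probability.Probability"
begin

definition uniform_hypergraph :: "nat \<Rightarrow> 'a set \<Rightarrow> 'a set set \<Rightarrow> bool" where
  "uniform_hypergraph k V E \<longleftrightarrow> finite V \<and> E \<subseteq> Pow V \<and> (\<forall>e\<in>E. card e = k)"

(* Hyperedges other than e itself are counted, as is usual for the dependency degree in the
   Lovasz Local Lemma: each hyperedge is monochromatic in all x bicolorings with probability
   p = 2 ^ x / 2 ^ (k * x), and the condition d \<le> 2 ^ (x * (k - 1)) / exp 1 - 1 is the usual
   exp 1 * p * (d + 1) \<le> 1. Bounds of the form m / d are meant in ennreal, where m / 0 = \<infinity> for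
   m > 0 and 0 / 0 = 0. *)
definition hyperedge_dependency :: "'a set set \<Rightarrow> 'a set \<Rightarrow> nat" where
  "hyperedge_dependency E e = card {f \<in> E. f \<noteq> e \<and> e \<inter> f \<noteq> {}}"

(* The supremum on nat is the maximum of a nonempty finite set, and 0 if E is empty. *)
definition dependency :: "'a set set \<Rightarrow> nat" where
  "dependency E = (SUP e\<in>E. hyperedge_dependency E e)"

(* The two colors 0 and 1 are represented by False and True. Maps on V are extensional, so that
   distinct elements of this set are distinct maps on V. *)
definition bicolorings :: "'a set \<Rightarrow> ('a \<Rightarrow> bool) set" where
  "bicolorings V = V \<rightarrow>\<^sub>E UNIV"

definition monochromatic :: "('a \<Rightarrow> bool) \<Rightarrow> 'a set \<Rightarrow> bool" where
  "monochromatic X e \<longleftrightarrow> (\<exists>c. \<forall>v\<in>e. X v = c)"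

definition bicoloring_cover :: "'a set \<Rightarrow> 'a set set \<Rightarrow> ('a \<Rightarrow> bool) set \<Rightarrow> bool" where
  "bicoloring_cover V E C \<longleftrightarrow> C \<subseteq> bicolorings V \<and> (\<forall>e\<in>E. \<exists>X\<in>C. \<not> monochromatic X e)"

(* The value at (v, i) is the bit r_v^i. *)
type_synonym 'a bits = "'a \<times> nat \<Rightarrow> bool"

definition ith_bicoloring :: "'a set \<Rightarrow> 'a bits \<Rightarrow> nat \<Rightarrow> 'a \<Rightarrow> bool" where
  "ith_bicoloring V r i = (\<lambda>v\<in>V. r (v, i))"

definition uncovered :: "'a set \<Rightarrow> 'a set set \<Rightarrow> nat \<Rightarrow> 'a bits \<Rightarrow> 'a set set" where
  "uncovered V E x r = {e \<in> E. \<forall>i\<in>{1..x}. monochromatic (ith_bicoloring V r i) e}"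

(* Independent fair bits indexed by S; the value outside S is the dummy False. *)
definition random_bits :: "('a \<times> nat) set \<Rightarrow> 'a bits pmf" where
  "random_bits S = Pi_pmf S False (\<lambda>_. pmf_of_set UNIV)"

definition resample :: "nat \<Rightarrow> 'a set \<Rightarrow> 'a bits \<Rightarrow> 'a bits pmf" where
  "resample x e r = map_pmf (\<lambda>s. override_on r s (e \<times> {1..x})) (random_bits (e \<times> {1..x}))"

(* The resamplings done so far, latest first, each with the bits just before it. *)
type_synonym 'a history = "('a set \<times> 'a bits) list"

(* How the next hyperedge is picked is left open: the choice may be randomized and may depend on
   the current bits and on the whole history, but not on bits to be drawn later. *)
type_synonym 'a pick_rule = "'a history \<Rightarrow> 'a bits \<Rightarrow> 'a set pmf"

definition valid_pick_rule :: "'a set \<Rightarrow> 'a set set \<Rightarrow> nat \<Rightarrow> 'a pick_rule \<Rightarrow> bool" where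
  "valid_pick_rule V E x pick \<longleftrightarrow>
     (\<forall>h r. uncovered V E x r \<noteq> {} \<longrightarrow> set_pmf (pick h r) \<subseteq> uncovered V E x r)"

context
  fixes V :: "'a set" and E :: "'a set set" and x :: nat and pick :: "'a pick_rule"
begin

(* A sub-probability mass function: the missing mass is the probability of running forever. *)
partial_function (spmf) resample_loop ::
  "'a history \<Rightarrow> 'a bits \<Rightarrow> ('a history \<times> 'a bits) spmf" where
  "resample_loop h r =
     (if uncovered V E x r = {} then return_spmf (h, r)
      else bind_pmf (pick h r) (\<lambda>e.
           bind_pmf (resample x e r) (\<lambda>r'.
           resample_loop ((e, r) # h) r')))"

definition cover_algorithm :: "('a history \<times> 'a bits) spmf" where
  "cover_algorithm = bind_pmf (random_bits (V \<times> {1..x})) (resample_loop [])"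

end

definition resamplings_of :: "'a set \<Rightarrow> 'a history \<Rightarrow> nat" where
  "resamplings_of e h = count_list (map fst h) e"

(* One bit per index in V \<times> {1..x} at the start and per index in e \<times> {1..x} whenever the
   hyperedge e is resampled. *)
definition bits_drawn :: "'a set \<Rightarrow> nat \<Rightarrow> 'a history \<Rightarrow> nat" where
  "bits_drawn V x h = card (V \<times> {1..x}) + (\<Sum>(e, r)\<leftarrow>h. card (e \<times> {1..x}))"

end

theory Submission
  imports Defs
begin

text \<open>
  This is a Moser-Tardos argument without resampling table and witness trees. Let
  \<open>block S\<close> be the operator on functions of the bits that tests whether all hyperedges in \<open>S\<close> are
  uncovered and, if so, averages over a resampling of their bits. Blocks of disjoint sets of
  hyperedges commute, and the uniform distribution is an eigenvector of the adjoint operators, with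
  eigenvalue \<open>(1 / 2 ^ (x * (k - 1))) ^ card S\<close> if the hyperedges in \<open>S\<close> are disjoint.

  A chain with root \<open>e\<close> is a list of layers of pairwise disjoint hyperedges that ends in \<open>{e}\<close> and
  in which every layer consists of neighbors of the next one; it plays the role of a witness tree.
  Let \<open>visits e\<close> be the sum over all such chains of the products of their blocks, applied to 1.
  Because resampling \<open>f\<close> either commutes with a chain or extends it, in an injective way,
  \<open>visits e\<close> decreases in expectation in every step, and by 1 more if \<open>e\<close> is resampled. So it
  bounds the expected number of resamplings of \<open>e\<close> from the current bits. Its mean over the initial
  bits is at most the total weight of the chains, which the local lemma condition bounds by \<open>1 / d\<close>.
\<close>

section \<open>Integrals over sub-probability mass functions\<close>

lemma nn_integral_measure_spmf_bind_pmf: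
  "(\<integral>\<^sup>+ y. g y \<partial>measure_spmf (bind_pmf p q)) = (\<integral>\<^sup>+ x. \<integral>\<^sup>+ y. g y \<partial>measure_spmf (q x) \<partial>measure_pmf p)"
  by (simp add: measure_spmf_bind_pmf o_def nn_integral_bind[where B = "count_space UNIV"])

text \<open>By monotone convergence, upper bounds on expectations pass to limits of chains. This is
  the admissibility needed for fixed point induction on \<open>resample_loop\<close>.\<close>

lemma nn_integral_lub_spmf_le:
  fixes g :: "'b \<Rightarrow> ennreal"
  assumes chain: "Complete_Partial_Order.chain (ord_spmf (=)) Y" and "Y \<noteq> {}"
    and bound: "\<And>p. p \<in> Y \<Longrightarrow> (\<integral>\<^sup>+ y. g y \<partial>measure_spmf p) \<le> c"
  shows "(\<integral>\<^sup>+ y. g y \<partial>measure_spmf (lub_spmf Y)) \<le> c"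
proof -
  \<comment> \<open>The support of an spmf is countable; this makes monotone convergence available
    for a chain that need not be a sequence.\<close>
  let ?M = "count_space (set_spmf (lub_spmf Y))"
  have chain': "Complete_Partial_Order.chain (\<le>) ((\<lambda>p x. ennreal (spmf p x) * g x) ` Y)"
    using chain by (rule chain_imageI) (auto simp: le_fun_def intro!: mult_right_mono dest: monotone_spmf[THEN monotoneD])
  have "(\<integral>\<^sup>+ y. g y \<partial>measure_spmf (lub_spmf Y)) = (\<integral>\<^sup>+ x. (SUP p\<in>Y. ennreal (spmf p x) * g x) \<partial>?M)"
    unfolding nn_integral_measure_spmf'
    by (simp add: ennreal_spmf_lub_spmf[OF chain \<open>Y \<noteq> {}\<close>] SUP_mult_right_ennreal \<open>Y \<noteq> {}\<close>)
  also have "\<dots> = (SUP p\<in>Y. \<integral>\<^sup>+ x. ennreal (spmf p x) * g x \<partial>?M)"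
    using \<open>Y \<noteq> {}\<close> chain' by (rule nn_integral_monotone_convergence_SUP_countable) simp
  also have "\<dots> \<le> c"
  proof (rule SUP_least)
    fix p assume "p \<in> Y"
    have "(\<integral>\<^sup>+ x. ennreal (spmf p x) * g x \<partial>?M) \<le> (\<integral>\<^sup>+ x. ennreal (spmf p x) * g x \<partial>count_space UNIV)"
      by (auto simp: nn_integral_count_space_indicator intro!: nn_integral_mono split: split_indicator)
    then show "(\<integral>\<^sup>+ x. ennreal (spmf p x) * g x \<partial>?M) \<le> c"
      using bound[OF \<open>p \<in> Y\<close>] by (simp add: nn_integral_measure_spmf)
  qed
  finally show ?thesis .
qed


section \<open>Block operators\<close>

lemma nn_integral_measure_pmf_swap:
  "(\<integral>\<^sup>+ a. \<integral>\<^sup>+ b. f a b \<partial>measure_pmf q \<partial>measure_pmf p) = (\<integral>\<^sup>+ b. \<integral>\<^sup>+ a. f a b \<partial>measure_pmf p \<partial>measure_pmf q)"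
proof -
  have "(\<integral>\<^sup>+ a. \<integral>\<^sup>+ b. f a b \<partial>q \<partial>p) = (\<integral>\<^sup>+ (a, b). f a b \<partial>pair_pmf p q)"
    by (simp add: nn_integral_pair_pmf')
  also have "\<dots> = (\<integral>\<^sup>+ b. \<integral>\<^sup>+ a. f a b \<partial>p \<partial>q)"
    by (subst pair_commute_pmf) (simp add: nn_integral_pair_pmf' case_prod_unfold)
  finally show ?thesis .
qed

lemma random_bits_Un:
  assumes "finite I" "finite J" "I \<inter> J = {}"
  shows "random_bits (I \<union> J) =
    map_pmf (\<lambda>(r, s). override_on s r I) (pair_pmf (random_bits I) (random_bits J))"
  unfolding random_bits_def Pi_pmf_union[OF assms]
  by (auto simp: override_on_def fun_eq_iff intro!: map_pmf_cong)

lemma nn_integral_random_bits_Un: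
  fixes g :: "('a \<times> nat \<Rightarrow> bool) \<Rightarrow> ennreal"
  assumes "finite I" "finite J" "I \<inter> J = {}"
  shows "(\<integral>\<^sup>+ s. g s \<partial>random_bits (I \<union> J)) =
    (\<integral>\<^sup>+ r. \<integral>\<^sup>+ s. g (override_on s r I) \<partial>random_bits J \<partial>random_bits I)"
  by (simp add: random_bits_Un[OF assms] nn_integral_pair_pmf')

text \<open>This locality is why tests and resamplings of disjoint hyperedges do not
  interfere.\<close>

lemma uncovered_cong:
  assumes "e \<subseteq> V" "\<And>v i. v \<in> e \<Longrightarrow> i \<in> {1..x} \<Longrightarrow> r (v, i) = s (v, i)"
  shows "e \<in> uncovered V E x r \<longleftrightarrow> e \<in> uncovered V E x s"
proof -
  have "monochromatic (ith_bicoloring V r i) e \<longleftrightarrow> monochromatic (ith_bicoloring V s i) e" if "i \<in> {1..x}" for i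
    using assms that unfolding monochromatic_def ith_bicoloring_def by (auto simp: subset_eq)
  then show ?thesis by (simp add: uncovered_def)
qed

text \<open>If \<open>e\<close> is monochromatic in all \<open>x\<close> bicolorings, the bits of a
  single vertex \<open>w\<close> determine those of all others. So at most \<open>2 ^ x\<close> of
  the \<open>2 ^ (x * card e)\<close> equally likely assignments qualify.\<close>

lemma prob_uncovered_le:
  fixes e :: "'a set"
  assumes "finite e" "e \<noteq> {}" "e \<subseteq> V" " {1..x} \<subseteq> J"
  shows "measure (random_bits (e \<times> {1..x})) {r. e \<in> uncovered V E x r} \<le> 1 / 2 ^ (x * (card e - 1))"
proof -
  let ?I = "e \<times> {1..x}"
  let ?A = "PiE_dflt ?I False (\<lambda>_. UNIV :: bool set)"
  obtain w where w: "w \<in> e" using assms by auto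
  have finA: "finite ?A" using assms by auto
  have cardA: "card ?A = 2 ^ (x * card e)"
    using assms by (subst card_PiE_dflt) (auto simp: card_cartesian_product mult.commute)
  have neA: "?A \<noteq> {}" using cardA by fastforce
  have inj: "inj_on (\<lambda>r. {i \<in> {1..x}. r (w, i)}) (?A \<inter> {r. e \<in> uncovered V E x r})"
  proof (rule inj_onI, rule ext)
    fix r s :: "'a bits" and j :: "'a \<times> nat"
    assume r: "r \<in> ?A \<inter> {r. e \<in> uncovered V E x r}" and s: "s \<in> ?A \<inter> {r. e \<in> uncovered V E x r}"
      and eq: "{i \<in> {1..x}. r (w, i)} = {i \<in> {1..x}. s (w, i)}"
    obtain v i where j: "j = (v, i)" by (cases j)
    have mono: "t (v, i) = t (w, i)" if "v \<in> e" "i \<in> {1..x}" "e \<in> uncovered V E x t" for t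
    proof -
      have "monochromatic (ith_bicoloring V t i) e" using that by (simp add: uncovered_def)
      then show ?thesis
        using that w \<open>e \<subseteq> V\<close> by (auto simp: monochromatic_def ith_bicoloring_def subset_eq)
    qed
    show "r j = s j"
    proof (cases "v \<in> e \<and> i \<in> {1..x}")
      case True
      then show ?thesis using mono[of r] mono[of s] r s eq unfolding j by auto
    next
      case False
      then have "j \<notin> ?I" unfolding j by auto
      then have "\<not> r j" "\<not> s j" using r s unfolding PiE_dflt_def by blast+
      then show ?thesis by simp
    qed
  qed
  have "card (?A \<inter> {r. e \<in> uncovered V E x r}) \<le> card (Pow {1..x})"
    using inj by (rule card_inj_on_le) auto
  also have "\<dots> = 2 ^ x" by (simp add: card_Pow)
  finally have card_le: "card (?A \<inter> {r. e \<in> uncovered V E x r}) \<le> 2 ^ x" .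
  have "random_bits ?I = pmf_of_set ?A"
    unfolding random_bits_def using assms by (intro Pi_pmf_of_set) auto
  then have "measure (random_bits ?I) {r. e \<in> uncovered V E x r} =
      real (card (?A \<inter> {r. e \<in> uncovered V E x r})) / 2 ^ (x * card e)"
    using finA neA by (simp add: measure_pmf_of_set cardA del: One_nat_def)
  also have "\<dots> \<le> 2 ^ x / 2 ^ (x * card e)"
    using card_le by (intro divide_right_mono) (simp_all flip: of_nat_power)
  also have "x * card e = x + x * (card e - 1)"
    using assms by (cases "card e") auto
  then have "2 ^ x / 2 ^ (x * card e) = (1 / 2 ^ (x * (card e - 1)) :: real)"
    by (simp add: power_add)
  finally show ?thesis .
qed

locale resampling =
  fixes V :: "'a set" and E :: "'a set set" and x :: nat
  assumes finite_V: "finite V" and E_subset: "E \<subseteq> Pow V" and nonempty: "{} \<notin> E"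
begin

lemma finite_E: "finite E"
  using finite_V E_subset by (meson finite_Pow_iff finite_subset)

definition block :: "'a set set \<Rightarrow> ('a bits \<Rightarrow> ennreal) \<Rightarrow> 'a bits \<Rightarrow> ennreal" where
  "block S g r =
    (if S \<subseteq> uncovered V E x r then \<integral>\<^sup>+ r'. g r' \<partial>resample x (\<Union>S) r else 0)"

lemma block_mono: "(\<And>r. g r \<le> g' r) \<Longrightarrow> block S g r \<le> block S g' r"
  by (auto simp: block_def intro!: nn_integral_mono)

lemma block_one_le: "block S (\<lambda>_. 1) r \<le> 1"
  by (simp add: block_def)

text \<open>Resampling the vertices of \<open>S\<close> does not affect the test for
  \<open>T\<close>, and successive resamplings of disjoint sets of bits have the law of a joint one.
  As \<open>S \<union> T\<close> is symmetric, disjoint blocks commute.\<close>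

lemma block_Un:
  assumes S: "S \<subseteq> E" and T: "T \<subseteq> E" and disj: "\<Union>S \<inter> \<Union>T = {}"
  shows "block S (block T g) = block (S \<union> T) g"
proof
  fix r
  let ?I = "\<Union>S \<times> {1..x}" and ?J = "\<Union>T \<times> {1..x}"
  have "\<Union>S \<subseteq> V" "\<Union>T \<subseteq> V" using S T E_subset by auto
  then have fin: "finite ?I" "finite ?J" using finite_V by (auto intro: finite_subset)
  have U: "(\<Union>(S \<union> T)) \<times> {1..x} = ?I \<union> ?J" by auto
  have disj': "?I \<inter> ?J = {}" using disj by auto
  have unc: "T \<subseteq> uncovered V E x (override_on r s ?I) \<longleftrightarrow> T \<subseteq> uncovered V E x r" for s
  proof -
    have "e \<in> uncovered V E x (override_on r s ?I) \<longleftrightarrow> e \<in> uncovered V E x r" if "e \<in> T" for e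
      using that disj T E_subset by (intro uncovered_cong) (auto simp: override_on_def)
    then show ?thesis by auto
  qed
  have comm: "override_on r (override_on t s ?I) (?I \<union> ?J) = override_on (override_on r s ?I) t ?J" for s t
    using disj by (auto simp: override_on_def fun_eq_iff)
  show "block S (block T g) r = block (S \<union> T) g r"
    unfolding block_def resample_def nn_integral_map_pmf U unc
      nn_integral_random_bits_Un[OF fin disj'] comm by simp
qed

text \<open>The test reads only the bits of \<open>e\<close>, which are then overwritten by fresh
  uniform ones. So the result is again uniform and independent of the test, and the mean is the
  probability of the test times the mean of \<open>g\<close>.\<close>

lemma nn_integral_block_singleton:
  assumes e: "e \<in> E"
  shows "(\<integral>\<^sup>+ r. block {e} g r \<partial>random_bits (V \<times> {1..x})) \<le>
    ennreal (1 / 2 ^ (x * (card e - 1))) * (\<integral>\<^sup>+ r. g r \<partial>random_bits (V \<times> {1..x}))"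
proof -
  let ?I = "e \<times> {1..x}" and ?J = "(V - e) \<times> {1..x}"
  let ?G = "\<integral>\<^sup>+ r. g r \<partial>random_bits (V \<times> {1..x})"
  have eV: "e \<subseteq> V" using e E_subset by auto
  have fin: "finite ?I" "finite ?J" using eV finite_V by (auto intro: finite_subset)
  have disj: "?I \<inter> ?J = {}" by auto
  have U: "V \<times> {1..x} = ?I \<union> ?J" using eV by auto
  have unc: "e \<in> uncovered V E x (override_on s r ?I) \<longleftrightarrow> e \<in> uncovered V E x r" for r s
    using eV by (intro uncovered_cong) (auto simp: override_on_def)
  have ov: "override_on (override_on s r ?I) t ?I = override_on s t ?I" for r s t :: "'a bits"
    by (auto simp: override_on_def fun_eq_iff)
  have G: "?G = (\<integral>\<^sup>+ s. \<integral>\<^sup>+ t. g (override_on s t ?I) \<partial>random_bits ?I \<partial>random_bits ?J)"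
    unfolding U nn_integral_random_bits_Un[OF fin disj]
    by (rule nn_integral_measure_pmf_swap)
  have "(\<integral>\<^sup>+ r. block {e} g r \<partial>random_bits (V \<times> {1..x})) =
      (\<integral>\<^sup>+ r. \<integral>\<^sup>+ s. indicator {r. e \<in> uncovered V E x r} r *
        (\<integral>\<^sup>+ t. g (override_on s t ?I) \<partial>random_bits ?I) \<partial>random_bits ?J \<partial>random_bits ?I)"
    unfolding U nn_integral_random_bits_Un[OF fin disj]
    by (intro nn_integral_cong) (simp add: block_def unc resample_def ov del: One_nat_def)
  also have "\<dots> = (\<integral>\<^sup>+ r. indicator {r. e \<in> uncovered V E x r} r * ?G \<partial>random_bits ?I)"
    unfolding G by (simp add: nn_integral_cmult)
  also have "\<dots> = emeasure (random_bits ?I) {r. e \<in> uncovered V E x r} * ?G"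
    by (simp add: nn_integral_multc)
  also have "\<dots> \<le> ennreal (1 / 2 ^ (x * (card e - 1))) * ?G"
    using prob_uncovered_le[where e = e and V = V and E = E and x = x] e eV nonempty finite_V
    by (intro mult_right_mono) (auto simp: measure_pmf.emeasure_eq_measure intro!: ennreal_leI intro: finite_subset)
  finally show ?thesis .
qed

text \<open>By \<open>block_Un\<close> the hyperedges of \<open>S\<close> can be split off one at a
  time, each for a factor of at most \<open>p\<close>.\<close>

lemma nn_integral_block:
  assumes "S \<subseteq> E" and disj: "pairwise disjnt S"
    and unif: "\<And>e. e \<in> S \<Longrightarrow> 1 / 2 ^ (x * (card e - 1)) \<le> p"
  shows "(\<integral>\<^sup>+ r. block S g r \<partial>random_bits (V \<times> {1..x})) \<le>
    ennreal p ^ card S * (\<integral>\<^sup>+ r. g r \<partial>random_bits (V \<times> {1..x}))"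
proof -
  have "finite S" using \<open>S \<subseteq> E\<close> finite_E by (rule finite_subset)
  then show ?thesis using assms
  proof (induction S)
    case empty
    then show ?case by (simp add: block_def resample_def)
  next
    case (insert e S)
    have eq: "block (insert e S) g = block {e} (block S g)"
      using insert.prems insert.hyps by (subst block_Un) (auto simp: pairwise_insert disjnt_def)
    have "(\<integral>\<^sup>+ r. block (insert e S) g r \<partial>random_bits (V \<times> {1..x})) \<le>
        ennreal (1 / 2 ^ (x * (card e - 1))) * (\<integral>\<^sup>+ r. block S g r \<partial>random_bits (V \<times> {1..x}))"
      unfolding eq using insert.prems by (intro nn_integral_block_singleton) auto
    also have "\<dots> \<le> ennreal p * (ennreal p ^ card S * (\<integral>\<^sup>+ r. g r \<partial>random_bits (V \<times> {1..x})))"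
      using insert.prems by (intro mult_mono insert.IH ennreal_leI) (auto simp: pairwise_insert)
    finally show ?case using insert.hyps by (simp add: mult.assoc)
  qed
qed

section \<open>Chains\<close>

text \<open>As no hyperedge is empty, each one is its own neighbor, in contrast to
  \<open>hyperedge_dependency\<close>. So a hyperedge that is resampled twice in a row can occupy
  consecutive layers.\<close>

definition neighbors :: "'a set set \<Rightarrow> 'a set set" where
  "neighbors S = {f \<in> E. \<exists>e\<in>S. e \<inter> f \<noteq> {}}"

lemma neighbors_mono: "S \<subseteq> T \<Longrightarrow> neighbors S \<subseteq> neighbors T"
  by (auto simp: neighbors_def)

lemma in_neighbors_self: "e \<in> S \<Longrightarrow> e \<in> E \<Longrightarrow> e \<in> neighbors S"
  using nonempty unfolding neighbors_def by (metis (mono_tags, lifting) Int_absorb mem_Collect_eq)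

lemma disjoint_if_not_neighbor: "f \<in> E \<Longrightarrow> f \<notin> neighbors S \<Longrightarrow> \<Union>S \<inter> f = {}"
  by (auto simp: neighbors_def)

fun chain :: "'a set \<Rightarrow> 'a set set list \<Rightarrow> bool" where
  "chain e [] = False"
| "chain e (S # L) = (if L = [] then S = {e}
     else S \<noteq> {} \<and> S \<subseteq> neighbors (hd L) \<and> pairwise disjnt S \<and> chain e L)"

text \<open>The head of a list is the layer that is resampled first. The new hyperedge joins the
  layer just before the first one that contains one of its neighbors, or becomes a new head.\<close>

fun add_edge :: "'a set \<Rightarrow> 'a set set list \<Rightarrow> 'a set set list" where
  "add_edge f [] = []"
| "add_edge f (S # L) =
     (if f \<in> neighbors S then {f} # S # L
      else if L \<noteq> [] \<and> f \<in> neighbors (hd L) then insert f S # L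
      else S # add_edge f L)"

fun remove_edge :: "'a set \<Rightarrow> 'a set set list \<Rightarrow> 'a set set list" where
  "remove_edge f [] = []"
| "remove_edge f (S # L) =
     (if f \<in> S then if S = {f} then L else (S - {f}) # L else S # remove_edge f L)"

definition blocks :: "'a set set list \<Rightarrow> 'a bits \<Rightarrow> ennreal" where
  "blocks L = foldr block L (\<lambda>_. 1)"

lemma blocks_simps [simp]: "blocks [] = (\<lambda>_. 1)" "blocks (S # L) = block S (blocks L)"
  by (simp_all add: blocks_def)

lemma chain_layers:
  assumes "chain e L" "e \<in> E" "S \<in> set L"
  shows "S \<subseteq> E \<and> S \<noteq> {} \<and> pairwise disjnt S"
  using assms by (induction L) (auto simp: neighbors_def split: if_splits)

lemma length_add_edge: "length (add_edge f L) \<le> Suc (length L)"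
  by (induction L) auto

text \<open>An insertion further down must preserve the condition
  \<open>S \<subseteq> neighbors (hd L)\<close> of the layer above. It does, because a head that
  \<open>f\<close> does not touch may gain \<open>f\<close> but is never preceded by a new
  layer.\<close>

lemma hd_add_edge:
  assumes "L \<noteq> []" "f \<notin> neighbors (hd L)"
  shows "add_edge f L \<noteq> [] \<and> hd L \<subseteq> hd (add_edge f L)"
  using assms by (cases L) auto

lemma pairwise_disjnt_insert:
  assumes "f \<in> E" "f \<notin> neighbors S" "pairwise disjnt S"
  shows "pairwise disjnt (insert f S)"
  using assms disjoint_if_not_neighbor[OF assms(1,2)] by (auto simp: pairwise_insert disjnt_def)

lemma chain_add_edge:
  assumes "f \<in> E" "e \<in> E" "chain e L"
  shows "chain e (add_edge f L)"
  using assms(3)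
proof (induction L)
  case (Cons S L)
  show ?case
  proof (cases "f \<in> neighbors S \<or> L = []")
    case True
    then show ?thesis using Cons.prems by (auto simp: pairwise_insert)
  next
    case False
    then have S: "S \<subseteq> neighbors (hd L)" "pairwise disjnt S" "S \<noteq> {}" "chain e L" "f \<notin> neighbors S" "L \<noteq> []"
      using Cons.prems by (auto split: if_splits)
    show ?thesis
    proof (cases "f \<in> neighbors (hd L)")
      case True
      then show ?thesis using S pairwise_disjnt_insert[OF \<open>f \<in> E\<close>, of S] by simp
    next
      case False
      then show ?thesis
        using S Cons.IH hd_add_edge[of L f] neighbors_mono by simp blast
    qed
  qed
qed simp

text \<open>\<open>add_edge\<close> passes \<open>S\<close> only if \<open>f\<close> is not in
  \<open>neighbors S\<close>, hence not in \<open>S\<close>; so the inserted \<open>f\<close> is the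
  occurrence nearest to the head. Since layers are nonempty, a layer \<open>{f}\<close> must be new
  as a whole. The purpose is injectivity of \<open>add_edge f\<close> on chains.\<close>

lemma remove_add_edge:
  assumes "f \<in> E" "e \<in> E" "chain e L"
  shows "remove_edge f (add_edge f L) = L"
  using assms(3)
proof (induction L)
  case (Cons S L)
  have "S \<noteq> {}" "L \<noteq> [] \<Longrightarrow> chain e L" using Cons.prems by (auto split: if_splits)
  moreover have "f \<notin> S" if "f \<notin> neighbors S" using in_neighbors_self that \<open>f \<in> E\<close> by blast
  ultimately show ?case using Cons.IH by (cases "L = []") auto
qed simp

text \<open>The block of \<open>f\<close> commutes past layers disjoint from \<open>f\<close> and
  stops in front of the first layer that \<open>f\<close> touches, where \<open>add_edge\<close>
  puts it. If there is none, it reaches the constant 1 and is dropped, whence only an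
  inequality.\<close>

lemma block_blocks_le:
  assumes "f \<in> E" "\<And>S. S \<in> set L \<Longrightarrow> S \<subseteq> E"
  shows "block {f} (blocks L) r \<le> blocks (add_edge f L) r"
  using assms(2)
proof (induction L arbitrary: r)
  case Nil
  then show ?case by (simp add: block_one_le)
next
  case (Cons S L)
  show ?case
  proof (cases "f \<in> neighbors S")
    case False
    then have disj: "\<Union>S \<inter> f = {}" by (rule disjoint_if_not_neighbor[OF \<open>f \<in> E\<close>])
    have eq: "block {f} (block S g) = block (insert f S) g" "block S (block {f} g) = block (insert f S) g" for g
      using Cons.prems disj \<open>f \<in> E\<close> by (subst block_Un; auto)+
    have "block S (block {f} (blocks L)) r \<le> block S (blocks (add_edge f L)) r"
      using Cons by (intro block_mono) auto
    then show ?thesis using False by (simp add: eq)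
  qed simp
qed

lemma block_eq_resample: "f \<in> uncovered V E x r \<Longrightarrow> block {f} g r = (\<integral>\<^sup>+ r'. g r' \<partial>resample x f r)"
  by (simp add: block_def)

section \<open>The potential \<open>visits\<close> and its decrease in each step\<close>

definition chains :: "'a set \<Rightarrow> nat \<Rightarrow> 'a set set list set" where
  "chains e n = {L. chain e L \<and> length L \<le> n}"

lemma finite_chains:
  assumes "e \<in> E"
  shows "finite (chains e n)"
proof (rule finite_subset)
  show "chains e n \<subseteq> {L. set L \<subseteq> Pow E \<and> length L \<le> n}"
    using chain_layers assms by (fastforce simp: chains_def)
qed (simp add: finite_E finite_lists_length_le)

text \<open>The sum over all chains as a supremum of finite partial sums, increasing in
  \<open>n\<close>, so that monotone convergence applies.\<close>

definition visits :: "'a set \<Rightarrow> 'a bits \<Rightarrow> ennreal" where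
  "visits e r = (SUP n. \<Sum>L\<in>chains e n. blocks L r)"

lemma nn_integral_visits:
  assumes "e \<in> E"
  shows "(\<integral>\<^sup>+ r. visits e r \<partial>measure_pmf q) = (SUP n. \<Sum>L\<in>chains e n. \<integral>\<^sup>+ r. blocks L r \<partial>q)"
proof -
  have "incseq (\<lambda>n r. \<Sum>L\<in>chains e n. blocks L r)"
    by (auto simp: incseq_def le_fun_def chains_def finite_chains[OF assms, unfolded chains_def] intro!: sum_mono2)
  then show ?thesis
    unfolding visits_def by (subst nn_integral_monotone_convergence_SUP) (simp_all add: nn_integral_sum)
qed

text \<open>For uncovered \<open>f\<close> the mean after resampling is the value of
  \<open>block {f}\<close>, which \<open>block_blocks_le\<close> bounds by the chain extended with
  \<open>f\<close>. Different chains have different extensions, so these sum to a part of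
  \<open>visits e r\<close>. For \<open>e = f\<close> the chain \<open>[{e}]\<close> is not among
  them and adds 1.\<close>

lemma visits_superharmonic:
  assumes e: "e \<in> E" and f: "f \<in> uncovered V E x r"
  shows "of_bool (e = f) + (\<integral>\<^sup>+ r'. visits e r' \<partial>resample x f r) \<le> visits e r"
proof -
  have fE: "f \<in> E" using f by (simp add: uncovered_def)
  have step: "of_bool (e = f) + (\<Sum>L\<in>chains e n. \<integral>\<^sup>+ r'. blocks L r' \<partial>resample x f r) \<le> visits e r" for n
  proof -
    have inj: "inj_on (add_edge f) (chains e n)"
      by (rule inj_on_inverseI[where g = "remove_edge f"]) (use remove_add_edge[OF fE e] in \<open>auto simp: chains_def\<close>)
    have sub: "add_edge f ` chains e n \<subseteq> chains e (Suc n)"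
      using order_trans[OF length_add_edge] by (auto simp: chains_def intro: chain_add_edge[OF fE e])
    \<comment> \<open>Deleting \<open>e\<close> from \<open>[{e}]\<close> would leave the empty
      list, which is not a chain.\<close>
    have new: "[{e}] \<notin> add_edge e ` chains e n"
    proof
      assume "[{e}] \<in> add_edge e ` chains e n"
      then obtain L where "chain e L" "[{e}] = add_edge e L" by (auto simp: chains_def)
      then have "L = []" using remove_add_edge[OF e e, of L] by (metis remove_edge.simps(2) singletonI)
      then show False using \<open>chain e L\<close> by simp
    qed
    have root: "of_bool (e = f) = (\<Sum>L\<in>(if e = f then {[{e}]} else {}). blocks L r)"
      using f by (simp add: block_def)
    have le: "(\<Sum>L\<in>chains e n. \<integral>\<^sup>+ r'. blocks L r' \<partial>resample x f r) \<le> (\<Sum>L\<in>chains e n. blocks (add_edge f L) r)"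
    proof (rule sum_mono)
      fix L assume "L \<in> chains e n"
      then have "block {f} (blocks L) r \<le> blocks (add_edge f L) r"
        using chain_layers e by (intro block_blocks_le fE) (auto simp: chains_def)
      then show "(\<integral>\<^sup>+ r'. blocks L r' \<partial>resample x f r) \<le> blocks (add_edge f L) r"
        by (simp add: block_eq_resample[OF f])
    qed
    have image: "(\<Sum>L\<in>chains e n. blocks (add_edge f L) r) = (\<Sum>L\<in>add_edge f ` chains e n. blocks L r)"
      using inj by (simp add: sum.reindex)
    have "of_bool (e = f) + (\<Sum>L\<in>chains e n. \<integral>\<^sup>+ r'. blocks L r' \<partial>resample x f r) \<le>
        (\<Sum>L\<in>(if e = f then {[{e}]} else {}). blocks L r) + (\<Sum>L\<in>add_edge f ` chains e n. blocks L r)"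
      unfolding root image[symmetric] by (rule add_left_mono[OF le])
    also have "\<dots> = (\<Sum>L\<in>(if e = f then {[{e}]} else {}) \<union> add_edge f ` chains e n. blocks L r)"
      using new finite_chains[OF e] by (intro sum.union_disjoint[symmetric]) auto
    also have "\<dots> \<le> (\<Sum>L\<in>chains e (Suc n). blocks L r)"
      using sub finite_chains[OF e] by (intro sum_mono2) (auto simp: chains_def)
    also have "\<dots> \<le> visits e r" unfolding visits_def by (rule SUP_upper) simp
    finally show ?thesis .
  qed
  have "of_bool (e = f) + (\<integral>\<^sup>+ r'. visits e r' \<partial>resample x f r) =
      (SUP n. of_bool (e = f) + (\<Sum>L\<in>chains e n. \<integral>\<^sup>+ r'. blocks L r' \<partial>resample x f r))"
    unfolding nn_integral_visits[OF e] by (simp add: ennreal_SUP_add_right)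
  also have "\<dots> \<le> visits e r" using step by (rule SUP_least)
  finally show ?thesis .
qed
end

section \<open>The mean of \<open>visits\<close> under the local lemma condition\<close>

locale resampling_lll = resampling +
  fixes d :: nat and p y :: real
  assumes prob_le: "e \<in> E \<Longrightarrow> 1 / 2 ^ (x * (card e - 1)) \<le> p"
    and card_neighbors_le: "e \<in> E \<Longrightarrow> card (neighbors {e}) \<le> Suc d"
    and lll: "p * (1 + y) ^ Suc d \<le> y"
    and nonneg: "0 \<le> p" "0 \<le> y"
begin

definition weight :: "'a set set list \<Rightarrow> real" where
  "weight L = (\<Prod>S\<leftarrow>L. p ^ card S)"

lemma weight_simps [simp]: "weight [] = 1" "weight (S # L) = p ^ card S * weight L"
  by (simp_all add: weight_def)

lemma weight_nonneg: "0 \<le> weight L"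
  using nonneg by (induction L) auto

lemma nn_integral_blocks_le:
  assumes "\<And>S. S \<in> set L \<Longrightarrow> S \<subseteq> E \<and> pairwise disjnt S"
  shows "(\<integral>\<^sup>+ r. blocks L r \<partial>random_bits (V \<times> {1..x})) \<le> ennreal (weight L)"
  using assms
proof (induction L)
  case (Cons S L)
  have "(\<integral>\<^sup>+ r. blocks (S # L) r \<partial>random_bits (V \<times> {1..x})) \<le>
      ennreal p ^ card S * (\<integral>\<^sup>+ r. blocks L r \<partial>random_bits (V \<times> {1..x}))"
    using Cons.prems[of S] prob_le unfolding blocks_simps by (intro nn_integral_block) auto
  also have "\<dots> \<le> ennreal p ^ card S * ennreal (weight L)"
    using Cons by (intro mult_left_mono) auto
  finally show ?case
    using nonneg weight_nonneg by (simp add: ennreal_mult ennreal_power)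
qed simp

lemma sum_Pow_power: "finite A \<Longrightarrow> (\<Sum>T\<in>Pow A. y ^ card T) = (1 + y) ^ card A"
  using prod_add[of A "\<lambda>_. y" "\<lambda>_. 1"] by (simp add: add.commute)

lemma card_neighbors:
  assumes "S \<subseteq> E"
  shows "card (neighbors S) \<le> Suc d * card S"
proof -
  have "finite S" using assms finite_E by (rule finite_subset)
  have "card (neighbors S) \<le> (\<Sum>e\<in>S. card (neighbors {e}))"
  proof -
    have "neighbors S = (\<Union>e\<in>S. neighbors {e})" by (auto simp: neighbors_def)
    then show ?thesis using card_UN_le[OF \<open>finite S\<close>, of "\<lambda>e. neighbors {e}"] by simp
  qed
  also have "\<dots> \<le> (\<Sum>e\<in>S. Suc d)"
    using assms by (intro sum_mono card_neighbors_le) auto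
  finally show ?thesis by (simp add: mult.commute)
qed

lemma sum_layers_le:
  assumes "S \<subseteq> E"
  shows "p ^ card S * (\<Sum>T\<in>Pow (neighbors S). y ^ card T) \<le> y ^ card S"
proof -
  have "finite (neighbors S)" using finite_E by (simp add: neighbors_def)
  have "p ^ card S * (\<Sum>T\<in>Pow (neighbors S). y ^ card T) = p ^ card S * (1 + y) ^ card (neighbors S)"
    by (simp add: sum_Pow_power[OF \<open>finite (neighbors S)\<close>])
  also have "\<dots> \<le> p ^ card S * (1 + y) ^ (Suc d * card S)"
    using nonneg card_neighbors[OF assms] by (intro mult_left_mono power_increasing) auto
  also have "\<dots> = (p * (1 + y) ^ Suc d) ^ card S"
    by (simp only: power_mult power_mult_distrib)
  also have "\<dots> \<le> y ^ card S"
    using lll nonneg by (intro power_mono) auto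
  finally show ?thesis .
qed

text \<open>Chains that have reached length \<open>n + 1\<close> count with \<open>y\<close> instead of \<open>p\<close> for each hyperedge of
  their first layer, which pays in advance for all their extensions.\<close>

lemma sum_chains_le:
  assumes e: "e \<in> E"
  shows "(\<Sum>L\<in>chains e n. weight L) +
    (\<Sum>L | chain e L \<and> length L = Suc n. y ^ card (hd L) * weight (tl L)) \<le> y"
proof (induction n)
  case 0
  have "{L. chain e L \<and> length L = Suc 0} = {[{e}]}"
    by (auto simp: length_Suc_conv)
  moreover have "chains e 0 = {}" by (auto simp: chains_def)
  ultimately show ?case by simp
next
  case (Suc n)
  let ?C = "{L. chain e L \<and> length L = Suc n}"
  let ?T = "\<lambda>L. {T. T \<noteq> {} \<and> T \<subseteq> neighbors (hd L) \<and> pairwise disjnt T}"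
  have fin_nb: "finite (neighbors S)" for S using finite_E by (simp add: neighbors_def)
  have finT: "finite (?T L)" for L
    using fin_nb[of "hd L"] by (rule_tac finite_subset[of _ "Pow (neighbors (hd L))"]) auto
  have finC: "finite ?C"
    using finite_chains[OF e, of "Suc n"] by (rule rev_finite_subset) (auto simp: chains_def)
  have split: "chains e (Suc n) = chains e n \<union> ?C" "chains e n \<inter> ?C = {}"
    by (auto simp: chains_def)
  have ext: "{L. chain e L \<and> length L = Suc (Suc n)} = (\<lambda>(L, T). T # L) ` (SIGMA L:?C. ?T L)"
    by (fastforce simp: length_Suc_conv image_iff)
  have "(\<Sum>L | chain e L \<and> length L = Suc (Suc n). y ^ card (hd L) * weight (tl L)) =
      (\<Sum>(L, T)\<in>(SIGMA L:?C. ?T L). y ^ card T * weight L)"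
    unfolding ext by (subst sum.reindex) (auto simp: inj_on_def case_prod_unfold)
  also have "\<dots> = (\<Sum>L\<in>?C. \<Sum>T\<in>?T L. y ^ card T * weight L)"
    using finC finT by (subst sum.Sigma) auto
  \<comment> \<open>Stopping at \<open>L\<close> is counted as the choice \<open>T = {}\<close>, for
    which \<open>y ^ card T = 1\<close>.\<close>
  finally have "(\<Sum>L\<in>?C. weight L) +
      (\<Sum>L | chain e L \<and> length L = Suc (Suc n). y ^ card (hd L) * weight (tl L)) =
      (\<Sum>L\<in>?C. weight L * (\<Sum>T\<in>insert {} (?T L). y ^ card T))"
    using finT by (simp add: sum.distrib algebra_simps sum_distrib_left)
  also have "\<dots> \<le> (\<Sum>L\<in>?C. y ^ card (hd L) * weight (tl L))"
  proof (rule sum_mono)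
    fix L assume L: "L \<in> ?C"
    then obtain S L' where L': "L = S # L'" by (cases L) auto
    have S: "S \<subseteq> E" using chain_layers[of e L S] L e L' by auto
    have "weight L * (\<Sum>T\<in>insert {} (?T L). y ^ card T) \<le>
        weight L * (\<Sum>T\<in>Pow (neighbors S). y ^ card T)"
      using fin_nb[of S] nonneg unfolding L'
      by (intro mult_left_mono weight_nonneg sum_mono2) auto
    also have "\<dots> = weight L' * (p ^ card S * (\<Sum>T\<in>Pow (neighbors S). y ^ card T))"
      by (simp add: L')
    also have "\<dots> \<le> weight L' * y ^ card S"
      by (intro mult_left_mono weight_nonneg sum_layers_le S)
    finally show "weight L * (\<Sum>T\<in>insert {} (?T L). y ^ card T) \<le> y ^ card (hd L) * weight (tl L)"
      by (simp add: L' mult.commute)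
  qed
  finally show ?case
    using Suc finC finite_chains[OF e] split by (simp add: sum.union_disjoint)
qed

lemma nn_integral_visits_le:
  assumes e: "e \<in> E"
  shows "(\<integral>\<^sup>+ r. visits e r \<partial>random_bits (V \<times> {1..x})) \<le> ennreal y"
  unfolding nn_integral_visits[OF e]
proof (rule SUP_least)
  fix n
  have "(\<Sum>L\<in>chains e n. \<integral>\<^sup>+ r. blocks L r \<partial>random_bits (V \<times> {1..x})) \<le> (\<Sum>L\<in>chains e n. ennreal (weight L))"
    using chain_layers[OF _ e] by (intro sum_mono nn_integral_blocks_le) (auto simp: chains_def)
  also have "\<dots> = ennreal (\<Sum>L\<in>chains e n. weight L)"
    by (simp add: weight_nonneg)
  also have "\<dots> \<le> ennreal y"
  proof (rule ennreal_leI)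
    have "0 \<le> (\<Sum>L | chain e L \<and> length L = Suc n. y ^ card (hd L) * weight (tl L))"
      using nonneg weight_nonneg by (intro sum_nonneg) auto
    then show "(\<Sum>L\<in>chains e n. weight L) \<le> y" using sum_chains_le[OF e, of n] by linarith
  qed
  finally show "(\<Sum>L\<in>chains e n. \<integral>\<^sup>+ r. blocks L r \<partial>random_bits (V \<times> {1..x})) \<le> ennreal y" .
qed
end

section \<open>The resampling algorithm\<close>

text \<open>Suprema of functions are taken pointwise, so admissibility can be checked at each
  \<open>z\<close>. Below, \<open>z\<close> is the pair of history and bits, over which the
  induction hypothesis must remain general.\<close>

lemma admissible_pointwise_spmf:
  fixes P :: "'c \<Rightarrow> 'b spmf \<Rightarrow> bool"
  assumes "\<And>z Y. Complete_Partial_Order.chain (ord_spmf (=)) Y \<Longrightarrow> Y \<noteq> {} \<Longrightarrow> (\<And>p. p \<in> Y \<Longrightarrow> P z p) \<Longrightarrow> P z (lub_spmf Y)"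
  shows "spmf.admissible (\<lambda>l. \<forall>z. P z (l z))"
proof (rule ccpo.admissibleI, intro allI)
  fix A :: "('c \<Rightarrow> 'b spmf) set" and z
  assume chain: "Complete_Partial_Order.chain (fun_ord (ord_spmf (=))) A" and "A \<noteq> {}"
    and P: "\<forall>l\<in>A. \<forall>z. P z (l z)"
  have "Complete_Partial_Order.chain (ord_spmf (=)) {p. \<exists>l\<in>A. p = l z}"
    using chain by (rule chain_fun)
  then show "P z (fun_lub lub_spmf A z)"
    unfolding fun_lub_def using \<open>A \<noteq> {}\<close> P by (intro assms) auto
qed

text \<open>A supermartingale argument: \<open>c f\<close> is the cost of resampling
  \<open>f\<close>, and the potential \<open>\<Phi>\<close> pays for it. Runs that never end
  contribute nothing to the integral, so the bound does not presuppose termination.\<close>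

lemma nn_integral_resample_loop_le:
  fixes K :: "'a history \<Rightarrow> ennreal" and \<Phi> :: "'a bits \<Rightarrow> ennreal"
  assumes valid: "valid_pick_rule V E x pick"
    and K: "\<And>f r h. K ((f, r) # h) = c f + K h"
    and \<Phi>: "\<And>f r. f \<in> uncovered V E x r \<Longrightarrow> c f + (\<integral>\<^sup>+ r'. \<Phi> r' \<partial>resample x f r) \<le> \<Phi> r"
  shows "(\<integral>\<^sup>+ (h', r'). K h' \<partial>measure_spmf (resample_loop V E x pick h r)) \<le> K h + \<Phi> r"
proof -
  let ?P = "\<lambda>l :: 'a history \<times> 'a bits \<Rightarrow> ('a history \<times> 'a bits) spmf. \<forall>z. (\<integral>\<^sup>+ (h', r'). K h' \<partial>measure_spmf (l z)) \<le> K (fst z) + \<Phi> (snd z)"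
  have "\<forall>z. (\<integral>\<^sup>+ (h', r'). K h' \<partial>measure_spmf (case_prod (resample_loop V E x pick) z)) \<le> K (fst z) + \<Phi> (snd z)"
  proof (rule resample_loop.fixp_induct[where P = "\<lambda>l. ?P (case_prod l)"])
    show "spmf.admissible (\<lambda>l. ?P (case_prod (curry l)))"
      unfolding case_prod_curry
      by (rule admissible_pointwise_spmf) (rule nn_integral_lub_spmf_le)
    show "?P (case_prod (\<lambda>_ _. return_pmf None))"
      by (simp add: case_prod_unfold nn_integral_measure_spmf)
    fix l assume IH: "?P (case_prod l)"
    show "?P (case_prod (\<lambda>h r. if uncovered V E x r = {} then return_spmf (h, r)
        else pick h r \<bind> (\<lambda>e. resample x e r \<bind> l ((e, r) # h))))"
    proof
      fix z :: "'a history \<times> 'a bits"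
      obtain h r where z: "z = (h, r)" by (cases z)
      have "(\<integral>\<^sup>+ e. \<integral>\<^sup>+ r'. (\<integral>\<^sup>+ (h', r''). K h' \<partial>measure_spmf (l ((e, r) # h) r')) \<partial>resample x e r \<partial>pick h r) \<le> K h + \<Phi> r"
        if ne: "uncovered V E x r \<noteq> {}"
      proof -
        have "(\<integral>\<^sup>+ r'. (\<integral>\<^sup>+ (h', r''). K h' \<partial>measure_spmf (l ((e, r) # h) r')) \<partial>resample x e r) \<le> K h + \<Phi> r"
          if "e \<in> set_pmf (pick h r)" for e
        proof -
          have e: "e \<in> uncovered V E x r" using that ne valid by (auto simp: valid_pick_rule_def)
          have "(\<integral>\<^sup>+ r'. (\<integral>\<^sup>+ (h', r''). K h' \<partial>measure_spmf (l ((e, r) # h) r')) \<partial>resample x e r) \<le>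
              (\<integral>\<^sup>+ r'. (K h + c e) + \<Phi> r' \<partial>resample x e r)"
            using IH[rule_format, of "((e, r) # h, _)"] by (intro nn_integral_mono) (simp add: K ac_simps)
          also have "\<dots> = K h + (c e + (\<integral>\<^sup>+ r'. \<Phi> r' \<partial>resample x e r))"
            by (simp add: nn_integral_add ac_simps)
          also have "\<dots> \<le> K h + \<Phi> r" using \<Phi>[OF e] by (rule add_left_mono)
          finally show ?thesis .
        qed
        then have "(\<integral>\<^sup>+ e. \<integral>\<^sup>+ r'. (\<integral>\<^sup>+ (h', r''). K h' \<partial>measure_spmf (l ((e, r) # h) r')) \<partial>resample x e r \<partial>pick h r) \<le>
            (\<integral>\<^sup>+ e. K h + \<Phi> r \<partial>pick h r)"
          by (intro nn_integral_mono_AE) (simp add: AE_measure_pmf_iff)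
        then show ?thesis by simp
      qed
      then show "(\<integral>\<^sup>+ (h', r'). K h' \<partial>measure_spmf (case z of (h, r) \<Rightarrow>
          if uncovered V E x r = {} then return_spmf (h, r)
          else pick h r \<bind> (\<lambda>e. resample x e r \<bind> l ((e, r) # h)))) \<le> K (fst z) + \<Phi> (snd z)"
        by (simp add: z nn_integral_measure_spmf_bind_pmf measure_spmf_return_spmf nn_integral_return)
    qed
  qed
  then show ?thesis by (simp add: split_paired_all)
qed

text \<open>Partial correctness. That histories stay within \<open>E\<close> is what later allows
  their length to be split into counts per hyperedge.\<close>

lemma set_spmf_resample_loop:
  assumes valid: "valid_pick_rule V E x pick"
    and "(h', r') \<in> set_spmf (resample_loop V E x pick h r)" and "fst ` set h \<subseteq> E"
  shows "uncovered V E x r' = {} \<and> fst ` set h' \<subseteq> E"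
proof -
  let ?P = "\<lambda>l :: 'a history \<times> 'a bits \<Rightarrow> ('a history \<times> 'a bits) spmf. \<forall>z. fst ` set (fst z) \<subseteq> E \<longrightarrow>
    (\<forall>(h', r') \<in> set_spmf (l z). uncovered V E x r' = {} \<and> fst ` set h' \<subseteq> E)"
  have "?P (case_prod (resample_loop V E x pick))"
  proof (rule resample_loop.fixp_induct[where P = "\<lambda>l. ?P (case_prod l)"])
    show "spmf.admissible (\<lambda>l. ?P (case_prod (curry l)))"
      unfolding case_prod_curry
      by (rule admissible_pointwise_spmf) (auto simp: set_lub_spmf)
    show "?P (case_prod (\<lambda>_ _. return_pmf None))" by simp
    fix l assume IH: "?P (case_prod l)"
    have "fst ` set ((e, r) # h) \<subseteq> E" if "e \<in> set_pmf (pick h r)" "uncovered V E x r \<noteq> {}" "fst ` set h \<subseteq> E" for e r h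
    proof -
      have "e \<in> uncovered V E x r" using that valid unfolding valid_pick_rule_def by blast
      then show ?thesis using that by (simp add: uncovered_def)
    qed
    note step = this
    show "?P (case_prod (\<lambda>h r. if uncovered V E x r = {} then return_spmf (h, r)
        else pick h r \<bind> (\<lambda>e. resample x e r \<bind> l ((e, r) # h))))"
    proof (rule allI, rule impI, rule ballI)
      fix z w
      assume z: "fst ` set (fst z) \<subseteq> E"
        and w: "w \<in> set_spmf (case_prod (\<lambda>h r. if uncovered V E x r = {} then return_spmf (h, r)
          else pick h r \<bind> (\<lambda>e. resample x e r \<bind> l ((e, r) # h))) z)"
      obtain h r where hr: "z = (h, r)" by (cases z)
      show "case w of (h', r') \<Rightarrow> uncovered V E x r' = {} \<and> fst ` set h' \<subseteq> E"
      proof (cases "uncovered V E x r = {}")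
        case True
        then show ?thesis using z w by (simp add: hr)
      next
        case False
        then obtain e r' where e: "e \<in> set_pmf (pick h r)" and "w \<in> set_spmf (l ((e, r) # h) r')"
          using w by (auto simp: hr set_spmf_bind_pmf bind_UNION)
        then show ?thesis
          using IH[rule_format, of "((e, r) # h, r')" w] step[OF e False] z by (simp add: hr)
      qed
    qed
  qed
  from this[rule_format, of "(h, r)" "(h', r')"] show ?thesis using assms by simp
qed

text \<open>Letting \<open>n\<close> tend to infinity shows that the loop terminates almost surely when \<open>\<Phi>\<close> is finite.\<close>

lemma weight_resample_loop_ge:
  assumes valid: "valid_pick_rule V E x pick"
    and \<Phi>: "\<And>f r. f \<in> uncovered V E x r \<Longrightarrow> 1 + (\<integral>\<^sup>+ r'. \<Phi> r' \<partial>resample x f r) \<le> \<Phi> r"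
  shows "of_nat n \<le> of_nat n * (\<integral>\<^sup>+ z. 1 \<partial>measure_spmf (resample_loop V E x pick h r)) + (\<Phi> r :: ennreal)"
\<comment> \<open>Fixed point induction starts from zero mass and cannot give a lower bound, so the
  loop is unfolded once per step of an induction on \<open>n\<close>.\<close>
proof (induction n arbitrary: h r)
  case (Suc n)
  let ?w = "\<lambda>h r. \<integral>\<^sup>+ z. 1 \<partial>measure_spmf (resample_loop V E x pick h r)"
  show ?case
  proof (cases "uncovered V E x r = {}")
    case True
    then have "?w h r = 1"
      by (subst resample_loop.simps) (simp add: measure_spmf_return_spmf nn_integral_return)
    then show ?thesis by simp
  next
    case False
    let ?q = "\<lambda>e. \<integral>\<^sup>+ r'. ?w ((e, r) # h) r' \<partial>resample x e r"
    have w: "?w h r = (\<integral>\<^sup>+ e. ?q e \<partial>pick h r)"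
      using False by (subst resample_loop.simps) (simp add: nn_integral_measure_spmf_bind_pmf del: nn_integral_const)
    have step: "of_nat (Suc n) \<le> of_nat (Suc n) * ?q e + \<Phi> r" if "e \<in> set_pmf (pick h r)" for e
    proof -
      have e: "e \<in> uncovered V E x r" using that False valid by (auto simp: valid_pick_rule_def)
      have "of_nat n = (\<integral>\<^sup>+ r'. of_nat n \<partial>resample x e r)" by simp
      also have "\<dots> \<le> (\<integral>\<^sup>+ r'. of_nat n * ?w ((e, r) # h) r' + \<Phi> r' \<partial>resample x e r)"
        by (intro nn_integral_mono Suc.IH)
      also have "\<dots> = of_nat n * ?q e + (\<integral>\<^sup>+ r'. \<Phi> r' \<partial>resample x e r)"
        by (simp add: nn_integral_add nn_integral_cmult del: nn_integral_const)
      \<comment> \<open>The 1 that \<open>\<Phi>\<close> pays for this resampling lifts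
        \<open>n\<close> to \<open>Suc n\<close>.\<close>
      finally have "of_nat (Suc n) \<le> of_nat n * ?q e + (1 + (\<integral>\<^sup>+ r'. \<Phi> r' \<partial>resample x e r))"
        by (simp add: ac_simps add_left_mono del: nn_integral_const)
      also have "\<dots> \<le> of_nat n * ?q e + \<Phi> r" by (intro add_left_mono \<Phi> e)
      also have "\<dots> \<le> of_nat (Suc n) * ?q e + \<Phi> r" by (intro add_right_mono mult_right_mono) auto
      finally show ?thesis .
    qed
    have "of_nat (Suc n) = (\<integral>\<^sup>+ e. of_nat (Suc n) \<partial>pick h r)" by simp
    also have "\<dots> \<le> (\<integral>\<^sup>+ e. of_nat (Suc n) * ?q e + \<Phi> r \<partial>pick h r)"
      using step by (intro nn_integral_mono_AE) (simp add: AE_measure_pmf_iff del: nn_integral_const)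
    also have "\<dots> = of_nat (Suc n) * ?w h r + \<Phi> r"
      unfolding w by (subst nn_integral_add) (simp_all add: nn_integral_cmult del: of_nat_Suc)
    finally show ?thesis .
  qed
qed simp

lemma length_eq_sum_resamplings_of:
  assumes "finite E" "fst ` set h \<subseteq> E"
  shows "length h = (\<Sum>e\<in>E. resamplings_of e h)"
  using sum_count_set[of "map fst h" E] assms by (simp add: resamplings_of_def)

lemma bits_drawn_uniform:
  assumes "\<And>e. e \<in> fst ` set h \<Longrightarrow> card e = k"
  shows "bits_drawn V x h = card V * x + k * x * length h"
proof -
  have "(\<Sum>(e, r)\<leftarrow>h. card (e \<times> {1..x})) = k * x * length h"
    using assms by (induction h) (auto simp: card_cartesian_product)
  then show ?thesis by (simp add: bits_drawn_def card_cartesian_product)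
qed

section \<open>Expected number of resamplings and almost sure termination\<close>

context resampling_lll begin

lemma nn_integral_resamplings_of_le:
  assumes "valid_pick_rule V E x pick" and e: "e \<in> E"
  shows "(\<integral>\<^sup>+ (h, r). of_nat (resamplings_of e h) \<partial>measure_spmf (cover_algorithm V E x pick)) \<le> ennreal y"
proof -
  have "(\<integral>\<^sup>+ (h, r). of_nat (resamplings_of e h) \<partial>measure_spmf (cover_algorithm V E x pick)) =
      (\<integral>\<^sup>+ r. \<integral>\<^sup>+ (h, r'). of_nat (resamplings_of e h) \<partial>measure_spmf (resample_loop V E x pick [] r) \<partial>random_bits (V \<times> {1..x}))"
    unfolding cover_algorithm_def by (rule nn_integral_measure_spmf_bind_pmf)
  also have "\<dots> \<le> (\<integral>\<^sup>+ r. visits e r \<partial>random_bits (V \<times> {1..x}))"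
  proof (rule nn_integral_mono)
    fix r
    have "(\<integral>\<^sup>+ (h, r'). of_nat (resamplings_of e h) \<partial>measure_spmf (resample_loop V E x pick [] r)) \<le>
        of_nat (resamplings_of e []) + visits e r"
      using assms visits_superharmonic
      by (intro nn_integral_resample_loop_le[where c = "\<lambda>f. of_bool (e = f)"]) (auto simp: resamplings_of_def)
    then show "(\<integral>\<^sup>+ (h, r'). of_nat (resamplings_of e h) \<partial>measure_spmf (resample_loop V E x pick [] r)) \<le> visits e r"
      by (simp add: resamplings_of_def)
  qed
  also have "\<dots> \<le> ennreal y" using e by (rule nn_integral_visits_le)
  finally show ?thesis .
qed

text \<open>Summed over all hyperedges, \<open>visits\<close> pays 1 for every resampling, whichever
  hyperedge is picked, and its mean is at most \<open>card E * y\<close>. A positive missing mass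
  \<open>1 - w\<close> would violate \<open>n * (1 - w) \<le> card E * y\<close> for large
  \<open>n\<close>.\<close>

lemma lossless_cover_algorithm:
  assumes "valid_pick_rule V E x pick"
  shows "lossless_spmf (cover_algorithm V E x pick)"
proof -
  let ?\<Phi> = "\<lambda>r. \<Sum>e\<in>E. visits e r"
  let ?\<mu> = "random_bits (V \<times> {1..x})"
  define w where "w = weight_spmf (cover_algorithm V E x pick)"
  have \<Phi>: "1 + (\<integral>\<^sup>+ r'. ?\<Phi> r' \<partial>resample x f r) \<le> ?\<Phi> r" if f: "f \<in> uncovered V E x r" for f r
  proof -
    have "f \<in> E" using f by (simp add: uncovered_def)
    then have "(\<Sum>e\<in>E. of_bool (e = f)) = (1 :: ennreal)" using finite_E by (simp add: of_bool_def)
    then have "1 + (\<integral>\<^sup>+ r'. ?\<Phi> r' \<partial>resample x f r) = (\<Sum>e\<in>E. of_bool (e = f) + (\<integral>\<^sup>+ r'. visits e r' \<partial>resample x f r))"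
      by (simp add: nn_integral_sum sum.distrib)
    also have "\<dots> \<le> ?\<Phi> r" by (intro sum_mono visits_superharmonic f)
    finally show ?thesis .
  qed
  have "real n \<le> real n * w + real (card E) * y" for n
  proof -
    have "of_nat n = (\<integral>\<^sup>+ r. of_nat n \<partial>?\<mu>)" by simp
    also have "\<dots> \<le> (\<integral>\<^sup>+ r. of_nat n * (\<integral>\<^sup>+ z. 1 \<partial>measure_spmf (resample_loop V E x pick [] r)) + ?\<Phi> r \<partial>?\<mu>)"
      by (intro nn_integral_mono weight_resample_loop_ge assms \<Phi>)
    also have "\<dots> = of_nat n * (\<integral>\<^sup>+ z. 1 \<partial>measure_spmf (cover_algorithm V E x pick)) + (\<integral>\<^sup>+ r. ?\<Phi> r \<partial>?\<mu>)"
      unfolding cover_algorithm_def nn_integral_measure_spmf_bind_pmf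
      by (subst nn_integral_add) (simp_all add: nn_integral_cmult del: nn_integral_const)
    also have "(\<integral>\<^sup>+ z. 1 \<partial>measure_spmf (cover_algorithm V E x pick)) = ennreal w"
      by (simp add: w_def measure_spmf.emeasure_eq_measure weight_spmf_def space_measure_spmf)
    also have "(\<integral>\<^sup>+ r. ?\<Phi> r \<partial>?\<mu>) = (\<Sum>e\<in>E. \<integral>\<^sup>+ r. visits e r \<partial>?\<mu>)"
      by (rule nn_integral_sum) simp
    also have "of_nat n * ennreal w + \<dots> \<le> of_nat n * ennreal w + (\<Sum>e\<in>E. ennreal y)"
      by (intro add_left_mono sum_mono nn_integral_visits_le)
    finally have "ennreal (real n) \<le> ennreal (real n * w + real (card E) * y)"
      using nonneg by (simp add: w_def weight_spmf_nonneg ennreal_of_nat_eq_real_of_nat ennreal_mult add_left_mono)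
    moreover have "0 \<le> real n * w + real (card E) * y"
      using nonneg by (simp add: w_def weight_spmf_nonneg)
    ultimately show ?thesis by (simp only: ennreal_le_iff)
  qed
  then have *: "real n * (1 - w) \<le> real (card E) * y" for n by (simp add: algebra_simps)
  have "w = 1"
  proof (rule ccontr)
    assume "w \<noteq> 1"
    then have "0 < 1 - w" using weight_spmf_le_1[of "cover_algorithm V E x pick"] by (simp add: w_def)
    then obtain n where "real (card E) * y < real n * (1 - w)" using reals_Archimedean3 by blast
    then show False using *[of n] by simp
  qed
  then show ?thesis by (simp add: lossless_spmf_def w_def)
qed

end

text \<open>For \<open>d = 0\<close> the bound \<open>1 / d\<close> is infinite, but almost sure termination needs a finite one.\<close>

lemma lll_parameters:
  fixes d M :: nat
  assumes "real d \<le> 2 ^ M / exp 1 - 1"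
  defines "y \<equiv> if d = 0 then 1 else 1 / real d"
  shows "1 / 2 ^ M * (1 + y) ^ Suc d \<le> y" and "0 \<le> y" and "ennreal y \<le> 1 / of_nat d"
proof -
  have p: "exp 1 * (1 + real d) \<le> 2 ^ M"
    using assms(1) by (simp add: field_simps)
  show "1 / 2 ^ M * (1 + y) ^ Suc d \<le> y"
  proof (cases "d = 0")
    case True
    \<comment> \<open>For \<open>d = 0\<close> and \<open>y = 1\<close> the claim amounts to
      \<open>2 \<le> 2 ^ M\<close>.\<close>
    have "2 \<le> exp (1::real)" using exp_ge_add_one_self[of 1] by simp
    then show ?thesis using p True by (simp add: y_def field_simps)
  next
    case False
    \<comment> \<open>Here y / (1 + y) = 1 / (d + 1), the standard choice in the symmetric local
      lemma.\<close>
    have "(1 + 1 / real d) ^ d \<le> exp (1 / real d) ^ d"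
      by (intro power_mono exp_ge_add_one_self) auto
    also have "\<dots> = exp 1" using False by (simp flip: exp_of_nat_mult)
    finally have "(1 + 1 / real d) ^ Suc d \<le> exp 1 * (1 + 1 / real d)"
      unfolding power_Suc2 by (intro mult_right_mono) auto
    also have "\<dots> = exp 1 * (1 + real d) * (1 / real d)" using False by (simp add: field_simps)
    also have "\<dots> \<le> 2 ^ M * (1 / real d)" using p by (intro mult_right_mono) auto
    finally show ?thesis using False by (simp add: y_def field_simps)
  qed
  show "0 \<le> y" by (simp add: y_def)
  show "ennreal y \<le> 1 / of_nat d"
  proof (cases "d = 0")
    case True
    then show ?thesis by (simp add: y_def ennreal_divide_eq_top_iff)
  next
    case False
    then show ?thesis by (simp add: y_def ennreal_of_nat_eq_real_of_nat divide_ennreal flip: ennreal_1)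
  qed
qed

section \<open>Existence of covers of the required size\<close>

lemma finite_bicolorings: "finite V \<Longrightarrow> finite (bicolorings V)"
  by (simp add: bicolorings_def finite_PiE)

lemma card_bicolorings: "finite V \<Longrightarrow> card (bicolorings V) = 2 ^ card V"
  by (simp add: bicolorings_def card_PiE)

lemma bicoloring_cover_ith_bicolorings:
  assumes "uncovered V E x r = {}"
  shows "bicoloring_cover V E (ith_bicoloring V r ` {1..x})"
  using assms by (auto simp: bicoloring_cover_def uncovered_def bicolorings_def ith_bicoloring_def)

lemma bicoloring_cover_superset:
  "bicoloring_cover V E C \<Longrightarrow> C \<subseteq> D \<Longrightarrow> D \<subseteq> bicolorings V \<Longrightarrow> bicoloring_cover V E D"
  unfolding bicoloring_cover_def by blast

text \<open>The existence of a cover is read off from a run of the algorithm, and this requires some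
  concrete rule.\<close>

lemma valid_pick_rule_exists: "\<exists>pick. valid_pick_rule V E x pick"
  by (rule exI[of _ "\<lambda>h r. return_pmf (SOME e. e \<in> uncovered V E x r)"])
    (auto simp: valid_pick_rule_def some_in_eq)

text \<open>There are only \<open>2 ^ n\<close> distinct bicolorings, hence the guard on
  \<open>card C = x\<close>.\<close>

theorem theorem13:
  fixes V :: "'a set" and E :: "'a set set" and k n m d x :: nat
  assumes "uniform_hypergraph k V E"
    and "n = card V" and "m = card E" and "d = dependency E"
    and "x > 0"
    and "real d \<le> 2 ^ (x * (k - 1)) / exp 1 - 1"
  shows "(\<exists>C. bicoloring_cover V E C \<and> card C \<le> x \<and> (x \<le> 2 ^ n \<longrightarrow> card C = x)) \<and>
    (\<forall>pick. valid_pick_rule V E x pick \<longrightarrow>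
       lossless_spmf (cover_algorithm V E x pick) \<and>
       (\<forall>(h, r) \<in> set_spmf (cover_algorithm V E x pick).
          bicoloring_cover V E (ith_bicoloring V r ` {1..x})) \<and>
       (\<forall>e\<in>E. (\<integral>\<^sup>+ (h, r). of_nat (resamplings_of e h) \<partial>measure_spmf (cover_algorithm V E x pick))
          \<le> (1 / of_nat d :: ennreal)) \<and>
       (\<integral>\<^sup>+ (h, r). of_nat (length h) \<partial>measure_spmf (cover_algorithm V E x pick))
          \<le> (of_nat m / of_nat d :: ennreal) \<and>
       (\<integral>\<^sup>+ (h, r). of_nat (bits_drawn V x h) \<partial>measure_spmf (cover_algorithm V E x pick))
          \<le> (of_nat (n * x) + of_nat (k * x) * (of_nat m / of_nat d) :: ennreal))"
proof -
  have fin: "finite V" and E: "E \<subseteq> Pow V" and unif: "\<And>e. e \<in> E \<Longrightarrow> card e = k"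
    using assms(1) by (auto simp: uniform_hypergraph_def)
  have finE: "finite E" using fin E by (meson finite_Pow_iff finite_subset)
  \<comment> \<open>For \<open>k = 0\<close> the truncated difference \<open>k - 1\<close> is 0, and
    the condition would read \<open>exp 1 * (1 + d) \<le> 1\<close>.\<close>
  have "k \<noteq> 0"
  proof
    assume "k = 0"
    then have "exp 1 * (1 + real d) \<le> 1" using assms(6) by (simp add: field_simps)
    moreover have "1 * 1 < exp 1 * (1 + real d)" by (intro mult_less_le_imp_less) auto
    ultimately show False by simp
  qed
  then have nonempty: "{} \<notin> E" using unif by force
  define y where "y = (if d = 0 then 1 else 1 / real d)"
  have y: "1 / 2 ^ (x * (k - 1)) * (1 + y) ^ Suc d \<le> y" "0 \<le> y" "ennreal y \<le> 1 / of_nat d"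
    unfolding y_def using lll_parameters[OF assms(6)] by simp_all
  interpret resampling V E x
    using fin E nonempty by unfold_locales
  \<comment> \<open>The extra neighbor is \<open>e\<close> itself.\<close>
  have nb: "card (neighbors {e}) \<le> Suc d" if "e \<in> E" for e
  proof -
    have "card (neighbors {e}) \<le> card (insert e {f \<in> E. f \<noteq> e \<and> e \<inter> f \<noteq> {}})"
      using finE by (intro card_mono) (auto simp: neighbors_def)
    also have "\<dots> \<le> Suc (hyperedge_dependency E e)"
      unfolding hyperedge_dependency_def by (rule card_insert_le_m1) auto
    also have "hyperedge_dependency E e \<le> d"
      unfolding assms(4) dependency_def using that finE by (intro cSUP_upper) auto
    finally show ?thesis by simp
  qed
  interpret resampling_lll V E x d "1 / 2 ^ (x * (k - 1))" y
    using y nb unif by unfold_locales auto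
  have supp: "uncovered V E x r = {} \<and> fst ` set h \<subseteq> E"
    if "valid_pick_rule V E x pick" "(h, r) \<in> set_spmf (cover_algorithm V E x pick)" for pick h r
    using that set_spmf_resample_loop[of V E x pick h r "[]"]
    by (auto simp: cover_algorithm_def set_spmf_bind_pmf)
  have cover: "bicoloring_cover V E (ith_bicoloring V r ` {1..x})"
    if "valid_pick_rule V E x pick" "(h, r) \<in> set_spmf (cover_algorithm V E x pick)" for pick h r
    using supp[OF that] by (intro bicoloring_cover_ith_bicolorings) simp
  have edge: "(\<integral>\<^sup>+ (h, r). of_nat (resamplings_of e h) \<partial>measure_spmf (cover_algorithm V E x pick)) \<le> (1 / of_nat d :: ennreal)"
    if "valid_pick_rule V E x pick" "e \<in> E" for pick e
    using nn_integral_resamplings_of_le[OF that] y(3) by (rule order_trans)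
  have total: "(\<integral>\<^sup>+ (h, r). of_nat (length h) \<partial>measure_spmf (cover_algorithm V E x pick)) \<le> (of_nat m / of_nat d :: ennreal)"
    if "valid_pick_rule V E x pick" for pick
  proof -
    have "(\<integral>\<^sup>+ (h, r). of_nat (length h) \<partial>measure_spmf (cover_algorithm V E x pick)) =
        (\<integral>\<^sup>+ z. (\<Sum>e\<in>E. case z of (h, r) \<Rightarrow> of_nat (resamplings_of e h)) \<partial>measure_spmf (cover_algorithm V E x pick))"
    proof (intro nn_integral_cong_AE, unfold AE_measure_spmf_iff, safe)
      fix h r assume "(h, r) \<in> set_spmf (cover_algorithm V E x pick)"
      then have "length h = (\<Sum>e\<in>E. resamplings_of e h)"
        using supp[OF that] finE by (intro length_eq_sum_resamplings_of) auto
      then show "(of_nat (length h) :: ennreal) = (\<Sum>e\<in>E. of_nat (resamplings_of e h))" by simp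
    qed
    also have "\<dots> = (\<Sum>e\<in>E. \<integral>\<^sup>+ (h, r). of_nat (resamplings_of e h) \<partial>measure_spmf (cover_algorithm V E x pick))"
      by (intro nn_integral_sum) simp
    also have "\<dots> \<le> (\<Sum>e\<in>E. 1 / of_nat d)"
      by (intro sum_mono edge that)
    finally show ?thesis by (simp add: assms(3) divide_ennreal_def)
  qed
  have bits: "(\<integral>\<^sup>+ (h, r). of_nat (bits_drawn V x h) \<partial>measure_spmf (cover_algorithm V E x pick))
      \<le> (of_nat (n * x) + of_nat (k * x) * (of_nat m / of_nat d) :: ennreal)"
    if "valid_pick_rule V E x pick" for pick
  proof -
    let ?A = "measure_spmf (cover_algorithm V E x pick)"
    have "(\<integral>\<^sup>+ (h, r). of_nat (bits_drawn V x h) \<partial>?A) =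
        (\<integral>\<^sup>+ z. of_nat (n * x) + of_nat (k * x) * (case z of (h, r) \<Rightarrow> of_nat (length h)) \<partial>?A)"
    proof (intro nn_integral_cong_AE, unfold AE_measure_spmf_iff, safe)
      fix h r assume "(h, r) \<in> set_spmf (cover_algorithm V E x pick)"
      then have "fst ` set h \<subseteq> E" using supp[OF that] by blast
      then have "bits_drawn V x h = n * x + k * x * length h"
        unfolding assms(2) by (intro bits_drawn_uniform unif) blast
      then show "(of_nat (bits_drawn V x h) :: ennreal) = of_nat (n * x) + of_nat (k * x) * of_nat (length h)"
        by simp
    qed
    also have "\<dots> = of_nat (n * x) * emeasure ?A (space ?A) + of_nat (k * x) * (\<integral>\<^sup>+ (h, r). of_nat (length h) \<partial>?A)"
      by (subst nn_integral_add) (simp_all add: nn_integral_cmult)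
    also have "\<dots> \<le> of_nat (n * x) * 1 + of_nat (k * x) * (of_nat m / of_nat d)"
      by (intro add_mono mult_left_mono total that measure_spmf.emeasure_space_le_1) auto
    finally show ?thesis by simp
  qed
  obtain pick where pick: "valid_pick_rule V E x pick" using valid_pick_rule_exists by blast
  \<comment> \<open>Termination with probability 1 yields at least one outcome, and every outcome
    provides a cover.\<close>
  have "set_spmf (cover_algorithm V E x pick) \<noteq> {}"
    using lossless_cover_algorithm[OF pick] measure_spmf_zero_iff[of "cover_algorithm V E x pick" UNIV]
    by (simp add: lossless_spmf_def weight_spmf_def)
  then obtain h r where "(h, r) \<in> set_spmf (cover_algorithm V E x pick)" by (metis ex_in_conv surj_pair)
  then have C: "bicoloring_cover V E (ith_bicoloring V r ` {1..x})" by (rule cover[OF pick])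
  have card_C: "card (ith_bicoloring V r ` {1..x}) \<le> x"
    using card_image_le[of "{1..x}" "ith_bicoloring V r"] by simp
  have "\<exists>C. bicoloring_cover V E C \<and> card C \<le> x \<and> (x \<le> 2 ^ n \<longrightarrow> card C = x)"
  \<comment> \<open>Some of the \<open>x\<close> computed bicolorings may coincide. If there are
    enough bicolorings, the cover is padded with arbitrary ones to exactly \<open>x\<close>, which
    keeps it a cover.\<close>
  proof (cases "x \<le> 2 ^ n")
    case True
    obtain D where "ith_bicoloring V r ` {1..x} \<subseteq> D" "D \<subseteq> bicolorings V" "card D = x"
      using exists_subset_between[OF card_C, of "bicolorings V"] True C
        card_bicolorings[OF fin] finite_bicolorings[OF fin] by (auto simp: assms(2) bicoloring_cover_def)
    then show ?thesis using bicoloring_cover_superset[OF C, of D] by (intro exI[of _ D]) simp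
  next
    case False
    then show ?thesis using C card_C by auto
  qed
  then show ?thesis
    using lossless_cover_algorithm cover edge total bits by blast
qed

end
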